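(* Let $F$ be an algebraic number field with maximal order $\mathcal{O}_F$. Let $P(X)=X^d+aX^t-b\in\mathcal{O}_F[X]$ be a monic irreducible trinomial with exponents $d>t\ge 1$ and middle coefficient $a=vb$ divisible by the absolute coefficient $b$ (with $v\in\mathcal{O}_F$). Let $E=F(\theta)$ be the extension field of degree $[E:F]=d$ generated by a zero $\theta$ of $P(X)$. Then $\theta$ is the generator of an ambiguous principal ideal $\theta\mathcal{O}_E$ with respect to $E/F$, with norm $\mathrm{N}_{E/F}(\theta)=(-1)^{d-1}b$, and $$U=\frac{\theta^d}{\mathrm{N}_{E/F}(\theta)}=(-1)^{d-1}(1-v\theta^t)\in U_E$$ is a unit of $E$.
   Context: For an extension $E/F$ of number fields of degree $d$ (not necessarily Galois), $\mathcal{I}_F,\mathcal{I}_E$ denote the groups of fractional ideals and $\iota:\mathcal{I}_F\to\mathcal{I}_E$, $\mathfrak{a}\mapsto\mathfrak{a}\mathcal{O}_E$, the embedding of ideal groups. An ideal $\mathfrak{A}\in\mathcal{I}_E$ is called ambiguous with respect to $E/F$ if its $d$-th power $\mathfrak{A}^d$ lies in $\iota(\mathcal{I}_F)$. $U_E$ denotes the unit group of the maximal order $\mathcal{O}_E$. *)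

theory Defs
  imports "Jordan_Normal_Form.Determinant"
begin

section \<open>Field extensions\<close>

text \<open>
  An extension \<open>E/F\<close> is a field homomorphism \<open>\<phi>\<close> between two field types. It makes \<open>E\<close> a vector
  space over \<open>F\<close>, and the notions of linear algebra below are those of the library locales
  \<^locale>\<open>module\<close> and \<^locale>\<open>vector_space\<close> at this scalar multiplication.
\<close>

definition ext_scale :: "('f \<Rightarrow> 'e) \<Rightarrow> 'f \<Rightarrow> 'e \<Rightarrow> 'e::field" where
  "ext_scale \<phi> c x = \<phi> c * x"

definition ext_degree :: "('f::field \<Rightarrow> 'e::field) \<Rightarrow> nat" where
  "ext_degree \<phi> = vector_space.dim (ext_scale \<phi>) UNIV"

definition ext_basis :: "('f::field \<Rightarrow> 'e::field) \<Rightarrow> 'e list \<Rightarrow> bool" where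
  "ext_basis \<phi> bs \<longleftrightarrow> distinct bs \<and> \<not> module.dependent (ext_scale \<phi>) (set bs)
     \<and> module.span (ext_scale \<phi>) (set bs) = UNIV"

text \<open>Column \<open>j\<close> holds the coordinates of \<open>x * bs ! j\<close> in the basis \<open>bs\<close>.\<close>

definition mult_matrix :: "('f::field \<Rightarrow> 'e::field) \<Rightarrow> 'e list \<Rightarrow> 'e \<Rightarrow> 'f mat" where
  "mult_matrix \<phi> bs x = mat (length bs) (length bs)
     (\<lambda>(i, j). module.representation (ext_scale \<phi>) (set bs) (x * bs ! j) (bs ! i))"

text \<open>
  The relative norm is the determinant of multiplication by \<open>x\<close>, which does not depend on the
  basis. Its value is an element of \<open>F\<close>.
\<close>

definition rel_norm :: "('f::field \<Rightarrow> 'e::field) \<Rightarrow> 'e \<Rightarrow> 'f" where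
  "rel_norm \<phi> x = det (mult_matrix \<phi> (SOME bs. ext_basis \<phi> bs) x)"

text \<open>\<open>F(\<theta>)\<close>, the smallest subfield of \<open>E\<close> containing the image of \<open>F\<close> and \<open>\<theta>\<close>:\<close>

inductive_set field_adjoin :: "('f \<Rightarrow> 'e::field) \<Rightarrow> 'e \<Rightarrow> 'e set"
  for \<phi> :: "'f \<Rightarrow> 'e::field" and \<theta> :: 'e where
  base: "\<phi> c \<in> field_adjoin \<phi> \<theta>"
| gen: "\<theta> \<in> field_adjoin \<phi> \<theta>"
| diff: "x \<in> field_adjoin \<phi> \<theta> \<Longrightarrow> y \<in> field_adjoin \<phi> \<theta> \<Longrightarrow> x - y \<in> field_adjoin \<phi> \<theta>"
| mult: "x \<in> field_adjoin \<phi> \<theta> \<Longrightarrow> y \<in> field_adjoin \<phi> \<theta> \<Longrightarrow> x * y \<in> field_adjoin \<phi> \<theta>"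
| inv: "x \<in> field_adjoin \<phi> \<theta> \<Longrightarrow> inverse x \<in> field_adjoin \<phi> \<theta>"


section \<open>Number fields, integers and units\<close>

definition number_field :: "'a::field_char_0 itself \<Rightarrow> bool" where
  "number_field _ \<longleftrightarrow> (\<exists>B :: 'a set. finite B \<and> module.span (ext_scale of_rat) B = UNIV)"

definition max_order :: "'a::field_char_0 set" where
  "max_order = {x. algebraic_int x}"

definition unit_group :: "'a::field_char_0 set" where
  "unit_group = {x \<in> max_order. \<exists>y \<in> max_order. x * y = 1}"


section \<open>Fractional ideals\<close>

definition fractional_ideals :: "'a::field_char_0 set set" where
  "fractional_ideals = {I. 0 \<in> I \<and> I \<noteq> {0}
     \<and> (\<forall>x \<in> I. \<forall>y \<in> I. x + y \<in> I)
     \<and> (\<forall>r \<in> max_order. \<forall>x \<in> I. r * x \<in> I)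
     \<and> (\<exists>c \<in> max_order. c \<noteq> 0 \<and> (\<forall>x \<in> I. c * x \<in> max_order))}"

definition ideal_prod :: "'a::field_char_0 set \<Rightarrow> 'a set \<Rightarrow> 'a set" where
  "ideal_prod I J = {\<Sum>k<n. f k * g k | f g (n::nat). (\<forall>k<n. f k \<in> I) \<and> (\<forall>k<n. g k \<in> J)}"

primrec ideal_pow :: "'a::field_char_0 set \<Rightarrow> nat \<Rightarrow> 'a set" where
  "ideal_pow I 0 = max_order"
| "ideal_pow I (Suc n) = ideal_prod I (ideal_pow I n)"

definition principal_ideal :: "'a::field_char_0 \<Rightarrow> 'a set" where
  "principal_ideal x = (\<lambda>r. x * r) ` max_order"

text \<open>The embedding of ideal groups, sending an ideal \<open>I\<close> of \<open>F\<close> to \<open>I\<O>\<^sub>E\<close>:\<close>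

definition ideal_embed :: "('f::field_char_0 \<Rightarrow> 'e::field_char_0) \<Rightarrow> 'f set \<Rightarrow> 'e set" where
  "ideal_embed \<phi> I = ideal_prod (\<phi> ` I) max_order"

definition ambiguous :: "('f::field_char_0 \<Rightarrow> 'e::field_char_0) \<Rightarrow> 'e set \<Rightarrow> bool" where
  "ambiguous \<phi> A \<longleftrightarrow> A \<in> fractional_ideals
     \<and> ideal_pow A (ext_degree \<phi>) \<in> ideal_embed \<phi> ` fractional_ideals"

end

theory Submission
  imports Defs "Jordan_Normal_Form.Char_Poly"
begin

text \<open>
  Since \<open>a = v * b\<close>, the equation of \<open>\<theta>\<close> reads \<open>\<theta> ^ d = b * (1 - v * \<theta> ^ t)\<close>. Everything rests
  on the fact that \<open>1 - v * \<theta> ^ t\<close> is a unit. Its inverse \<open>w\<close> satisfies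
  \<open>(w - 1) ^ d = v ^ d * b ^ t * w ^ (d - t)\<close>, a monic equation with integral coefficients, so \<open>w\<close>
  is integral (\<open>trinomial_unit\<close>). Consequently \<open>\<theta> ^ d\<close> and \<open>b\<close> generate the same ideal of \<open>E\<close>, which
  makes \<open>\<theta>\<O>\<^sub>E\<close> ambiguous.

  That a root of a monic polynomial with integral coefficients is integral, and that integers are
  closed under sums and products, follows from the characteristic polynomial of a multiplication
  matrix over \<open>\<int>\<close> (\<open>algebraic_int_of_finite_subring\<close>, \<open>algebraic_int_monic_root\<close>).

  The degree is \<open>d\<close> because \<open>1, \<theta>, \<dots>, \<theta> ^ (d - 1)\<close> is a basis (\<open>power_basis\<close>). In this basis
  multiplication by \<open>\<theta>\<close> is the companion matrix of \<open>P\<close>, whose determinant is the constant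
  coefficient up to the sign \<open>(- 1) ^ d\<close> (\<open>rel_norm_generator\<close>); with constant coefficient \<open>- b\<close>
  this is the norm, and the formula for \<open>U\<close> is the equation of \<open>\<theta>\<close> divided by it.
\<close>

section \<open>The algebraic integers form an integrally closed ring\<close>

interpretation int_module: Modules.module "\<lambda>(n::int) (x::'a::comm_ring_1). of_int n * x"
  by unfold_locales (simp_all add: algebra_simps)

text \<open>
  Subrings that are finitely generated as abelian groups are the certificates of integrality used
  here: every element of one is an algebraic integer, and every algebraic integer lies in one.
  Unlike single monic polynomials, they can be enlarged step by step, so sums and products need no
  explicit equation.
\<close>

definition finite_subring :: "'a::comm_ring_1 set \<Rightarrow> bool" where
  "finite_subring R \<longleftrightarrow> 1 \<in> R \<and> (\<forall>x\<in>R. \<forall>y\<in>R. x * y \<in> R)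
     \<and> (\<exists>S. finite S \<and> R = int_module.span S)"

lemma finite_subring_closed:
  assumes "finite_subring R"
  shows "1 \<in> R" "0 \<in> R"
    and "\<And>x y. x \<in> R \<Longrightarrow> y \<in> R \<Longrightarrow> x + y \<in> R"
    and "\<And>x y. x \<in> R \<Longrightarrow> y \<in> R \<Longrightarrow> x * y \<in> R"
    and "\<And>x. x \<in> R \<Longrightarrow> - x \<in> R"
    and "\<And>n. of_int n \<in> R"
proof -
  from assms obtain S where S: "R = int_module.span S"
    unfolding finite_subring_def by blast
  show one: "1 \<in> R" and "\<And>x y. x \<in> R \<Longrightarrow> y \<in> R \<Longrightarrow> x * y \<in> R"
    using assms unfolding finite_subring_def by blast+
  show "0 \<in> R" "\<And>x y. x \<in> R \<Longrightarrow> y \<in> R \<Longrightarrow> x + y \<in> R" "\<And>x. x \<in> R \<Longrightarrow> - x \<in> R"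
    unfolding S by (fact int_module.span_zero int_module.span_add int_module.span_neg)+
  show "of_int n \<in> R" for n
    using int_module.span_scale[of 1 S n] one unfolding S by simp
qed

lemma finite_subring_int_span: "finite_subring (int_module.span {1 :: 'a::comm_ring_1})"
  unfolding finite_subring_def int_module.span_singleton
  by (intro conjI exI[of _ "{1}"]) (auto simp: int_module.span_singleton
      image_iff intro: exI[of _ 1] simp flip: of_int_mult)

text \<open>
  Multiplication by \<open>x\<close> maps the generators to integer combinations of themselves. The vector of
  generators is therefore an eigenvector of an integer matrix with eigenvalue \<open>x\<close>, and the
  characteristic polynomial of that matrix is a monic integer polynomial with root \<open>x\<close>.
\<close>

lemma algebraic_int_of_finite_subring:
  fixes x :: "'a::field_char_0"
  assumes R: "finite_subring R" and x: "x \<in> R"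
  shows "algebraic_int x"
proof -
  from R obtain S where fin: "finite S" and RS: "R = int_module.span S"
    unfolding finite_subring_def by blast
  from fin obtain xs where xs: "set xs = S" "distinct xs"
    using finite_distinct_list by blast
  let ?n = "length xs"
  have coords: "\<exists>c :: nat \<Rightarrow> int. y = (\<Sum>j<?n. of_int (c j) * xs ! j)" if "y \<in> R" for y
  proof -
    from that obtain u where "y = (\<Sum>s\<in>S. of_int (u s) * s)"
      unfolding RS int_module.span_finite[OF fin] by auto
    also have "\<dots> = (\<Sum>j<?n. of_int (u (xs ! j)) * xs ! j)"
      by (rule sum.reindex_bij_betw[symmetric, where h = "\<lambda>j. xs ! j"])
         (use xs in \<open>simp add: bij_betw_nth\<close>)
    finally show ?thesis by (intro exI[of _ "\<lambda>j. u (xs ! j)"])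
  qed
  have "\<forall>i. \<exists>c :: nat \<Rightarrow> int. i < ?n \<longrightarrow> x * xs ! i = (\<Sum>j<?n. of_int (c j) * xs ! j)"
  proof
    fix i
    have "xs ! i \<in> R" if "i < ?n"
      unfolding RS using that xs by (intro int_module.span_base) auto
    then show "\<exists>c :: nat \<Rightarrow> int. i < ?n \<longrightarrow> x * xs ! i = (\<Sum>j<?n. of_int (c j) * xs ! j)"
      using coords finite_subring_closed(4)[OF R x] by blast
  qed
  then obtain c :: "nat \<Rightarrow> nat \<Rightarrow> int" where
    c: "\<And>i. i < ?n \<Longrightarrow> x * xs ! i = (\<Sum>j<?n. of_int (c i j) * xs ! j)"
    by metis
  \<comment> \<open>Row \<open>i\<close> expresses \<open>x\<close> times the generator \<open>xs ! i\<close> in the generators.\<close>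
  define A where "A = mat ?n ?n (\<lambda>(i, j). c i j)"
  define B :: "'a mat" where "B = map_mat of_int A"
  define w where "w = vec ?n (\<lambda>i. xs ! i)"
  have A: "A \<in> carrier_mat ?n ?n" by (simp add: A_def)
  have B: "B \<in> carrier_mat ?n ?n" by (simp add: A_def B_def)
  have "B *\<^sub>v w = x \<cdot>\<^sub>v w"
    by (rule eq_vecI) (auto simp: B_def A_def w_def scalar_prod_def c atLeast0LessThan)
  \<comment> \<open>If all generators vanished, the ring would not contain 1.\<close>
  moreover have "w \<noteq> 0\<^sub>v ?n"
  proof
    assume "w = 0\<^sub>v ?n"
    then have "xs ! i = 0" if "i < ?n" for i
      using that by (metis w_def index_vec index_zero_vec(1))
    then have "y = 0" if "y \<in> R" for y
      using coords[OF that] by auto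
    from this[OF finite_subring_closed(1)[OF R]] show False by simp
  qed
  ultimately have "eigenvalue B x"
    unfolding eigenvalue_def eigenvector_def using B by (intro exI[of _ w]) (auto simp: w_def)
  then have "poly (char_poly B) x = 0" using eigenvalue_root_char_poly[OF B] by simp
  then have "poly (map_poly of_int (char_poly A)) x = 0"
    unfolding B_def of_int_hom.char_poly_hom[OF A] .
  then show ?thesis
    unfolding algebraic_int_altdef_ipoly using degree_monic_char_poly[OF A] by auto
qed

lemma poly_root_power:
  fixes p :: "'a::comm_ring_1 poly"
  assumes "lead_coeff p = 1" and "poly p x = 0"
  shows "x ^ degree p = - (\<Sum>i<degree p. coeff p i * x ^ i)"
proof -
  have "poly p x = (\<Sum>i<degree p. coeff p i * x ^ i) + x ^ degree p"
    using assms(1) by (simp add: poly_altdef lessThan_Suc_atMost[symmetric])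
  then show ?thesis using assms(2) by (simp add: eq_neg_iff_add_eq_0 add.commute)
qed

text \<open>
  A monic equation of degree \<open>n\<close> rewrites \<open>x ^ n\<close> in lower powers, so the products \<open>s * x ^ i\<close> of a
  generator \<open>s\<close> of \<open>R\<close> with \<open>i < n\<close> generate \<open>R[x]\<close> as an abelian group.
\<close>

lemma finite_subring_adjoin_root:
  fixes x :: "'a::field_char_0"
  assumes R: "finite_subring R" and p: "lead_coeff p = 1" "\<forall>i. coeff p i \<in> R" "poly p x = 0"
  obtains R' where "finite_subring R'" "R \<subseteq> R'" "x \<in> R'"
proof -
  from R obtain S where fin: "finite S" and RS: "R = int_module.span S"
    unfolding finite_subring_def by blast
  define n where "n = degree p"
  define T where "T = (\<lambda>(s, i). s * x ^ i) ` (S \<times> {..<n})"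
  let ?R' = "int_module.span T"
  have n: "n > 0"
  proof (rule ccontr)
    assume "\<not> n > 0"
    then have "poly p x = 1" using p(1) by (auto simp: n_def poly_altdef)
    then show False using p(3) by simp
  qed
  have low: "r * x ^ i \<in> ?R'" if "r \<in> R" "i < n" for r i
    using that(1) unfolding RS
  proof (induction rule: int_module.span_induct_alt)
    case base
    show ?case by (simp add: int_module.span_zero)
  next
    case (step c s y)
    have "s * x ^ i \<in> ?R'"
      using step(1) that(2) by (intro int_module.span_base) (auto simp: T_def)
    then have "of_int c * (s * x ^ i) + y * x ^ i \<in> ?R'"
      by (intro int_module.span_add int_module.span_scale step)
    then show ?case by (simp add: algebra_simps)
  qed
  have all: "r * x ^ k \<in> ?R'" if "r \<in> R" for r k
    using that
  proof (induction k arbitrary: r rule: less_induct)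
    case (less k)
    show ?case
    proof (cases "k < n")
      case True
      then show ?thesis using low less.prems by blast
    next
      case False
      have "r * x ^ k = r * x ^ (k - n) * x ^ n"
        using False by (simp add: mult.assoc flip: power_add)
      also have "\<dots> = - (\<Sum>i<n. (r * coeff p i) * x ^ (k - n + i))"
        unfolding n_def poly_root_power[OF p(1,3)]
        by (simp add: sum_distrib_left power_add mult_ac)
      also have "\<dots> \<in> ?R'"
        using False less.prems p(2)
        by (intro int_module.span_neg int_module.span_sum less.IH finite_subring_closed(4)[OF R])
           auto
      finally show ?thesis .
    qed
  qed
  have prod: "y * z \<in> ?R'" if "y \<in> ?R'" "z \<in> ?R'" for y z
    using that(1)
  proof (induction rule: int_module.span_induct_alt)
    case base
    show ?case by (simp add: int_module.span_zero)
  next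
    case (step c u y)
    from that(2) have "u * z \<in> ?R'"
    proof (induction rule: int_module.span_induct_alt)
      case base
      show ?case by (simp add: int_module.span_zero)
    next
      case (step c' u' z)
      from \<open>u \<in> T\<close> \<open>u' \<in> T\<close> obtain s i s' j
        where "s \<in> S" "s' \<in> S" "u = s * x ^ i" "u' = s' * x ^ j"
        unfolding T_def by auto
      moreover from this have "s * s' \<in> R"
        by (intro finite_subring_closed(4)[OF R]) (auto simp: RS int_module.span_base)
      ultimately have "u * u' \<in> ?R'"
        using all[of "s * s'" "i + j"] by (simp add: power_add mult_ac)
      then have "of_int c' * (u * u') + u * z \<in> ?R'"
        by (intro int_module.span_add int_module.span_scale step)
      then show ?case by (simp add: algebra_simps)
    qed
    then have "of_int c * (u * z) + y * z \<in> ?R'"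
      by (intro int_module.span_add int_module.span_scale step)
    then show ?case by (simp add: algebra_simps)
  qed
  show thesis
  proof
    show "R \<subseteq> ?R'" using all[of _ 0] by auto
    then show "finite_subring ?R'"
      unfolding finite_subring_def using finite_subring_closed(1)[OF R] prod fin
      by (intro conjI exI[of _ T]) (auto simp: T_def)
    show "x \<in> ?R'" using all[of 1 1] finite_subring_closed(1)[OF R] by simp
  qed
qed

lemma finite_subring_containing:
  fixes C :: "'a::field_char_0 set"
  assumes "finite C" and "\<forall>c\<in>C. algebraic_int c"
  shows "\<exists>R. finite_subring R \<and> C \<subseteq> R"
  using assms
proof (induction rule: finite_induct)
  case empty
  show ?case using finite_subring_int_span by blast
next
  case (insert c C)
  then obtain R where R: "finite_subring R" "C \<subseteq> R" by auto
  from insert.prems obtain p where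
    p: "lead_coeff p = 1" "\<forall>i. coeff p i \<in> \<int>" "poly p c = 0"
    by (auto simp: algebraic_int.simps)
  have "\<forall>i. coeff p i \<in> R"
    using p(2) finite_subring_closed(6)[OF R(1)] by (metis Ints_cases)
  from finite_subring_adjoin_root[OF R(1) p(1) this p(3)]
  obtain R' where "finite_subring R'" "R \<subseteq> R'" "c \<in> R'" .
  with R(2) show ?case by (intro exI[of _ R']) simp
qed

text \<open>
  Transitivity of integrality: all the coefficients lie in a common finitely generated ring, and
  adjoining the root keeps it finitely generated.
\<close>

lemma algebraic_int_monic_root:
  fixes x :: "'a::field_char_0"
  assumes "lead_coeff p = 1" "\<forall>i. algebraic_int (coeff p i)" "poly p x = 0"
  shows "algebraic_int x"
proof -
  have "\<forall>c\<in>set (coeffs p). algebraic_int c"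
  proof
    fix c assume "c \<in> set (coeffs p)"
    then have "c \<in> range (coeff p)" by (simp add: range_coeff)
    then obtain i where "c = coeff p i" by (rule rangeE)
    with assms(2) show "algebraic_int c" by (simp only:)
  qed
  from finite_subring_containing[OF _ this]
  obtain R where R: "finite_subring R" "set (coeffs p) \<subseteq> R" by force
  have "coeff p i \<in> R" for i
  proof (cases "coeff p i = 0")
    case True
    then show ?thesis using finite_subring_closed(2)[OF R(1)] by simp
  next
    case False
    then have "coeff p i \<in> set (coeffs p)" by (intro coeff_in_coeffs) (auto intro: le_degree)
    with R(2) show ?thesis ..
  qed
  then have "\<forall>i. coeff p i \<in> R" ..
  from finite_subring_adjoin_root[OF R(1) assms(1) this assms(3)]
  obtain R' where "finite_subring R'" "x \<in> R'" .
  then show ?thesis by (rule algebraic_int_of_finite_subring)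
qed

lemma algebraic_int_add_mult:
  fixes x y :: "'a::field_char_0"
  assumes "algebraic_int x" "algebraic_int y"
  shows algebraic_int_add: "algebraic_int (x + y)"
    and algebraic_int_mult: "algebraic_int (x * y)"
proof -
  obtain R where R: "finite_subring R" "x \<in> R" "y \<in> R"
    using finite_subring_containing[of "{x, y}"] assms by force
  show "algebraic_int (x + y)" "algebraic_int (x * y)"
    by (rule algebraic_int_of_finite_subring[OF R(1)], rule finite_subring_closed(3,4)[OF R])+
qed

lemma max_order_0: "0 \<in> max_order"
  by (simp add: max_order_def)

lemma max_order_1: "1 \<in> max_order"
  unfolding max_order_def by (intro CollectI int_imp_algebraic_int) simp

lemma max_order_uminus: "x \<in> max_order \<Longrightarrow> - x \<in> max_order"
  by (simp add: max_order_def)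

lemma max_order_add: "x \<in> max_order \<Longrightarrow> y \<in> max_order \<Longrightarrow> x + y \<in> max_order"
  unfolding max_order_def using algebraic_int_add by blast

lemma max_order_diff: "x \<in> max_order \<Longrightarrow> y \<in> max_order \<Longrightarrow> x - y \<in> max_order"
  using max_order_add[OF _ max_order_uminus, of x y] by simp

lemma max_order_mult: "x \<in> max_order \<Longrightarrow> y \<in> max_order \<Longrightarrow> x * y \<in> max_order"
  unfolding max_order_def using algebraic_int_mult by blast

lemmas max_order_closed = max_order_0 max_order_1 max_order_uminus max_order_add
  max_order_diff max_order_mult

lemma max_order_power: "x \<in> max_order \<Longrightarrow> x ^ n \<in> max_order"
  by (induction n) (simp_all add: max_order_closed)

lemma max_order_sum:
  "(\<And>i. i \<in> A \<Longrightarrow> f i \<in> max_order) \<Longrightarrow> sum f A \<in> max_order"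
  by (induction A rule: infinite_finite_induct) (simp_all add: max_order_closed)

lemma max_order_hom:
  fixes \<phi> :: "'f::field_char_0 \<Rightarrow> 'e::field_char_0"
  assumes "field_hom \<phi>" and "x \<in> max_order"
  shows "\<phi> x \<in> max_order"
proof -
  interpret field_hom \<phi> by fact
  from assms(2) obtain p where p: "poly (map_poly of_int p) x = 0" "lead_coeff p = 1"
    by (auto simp: max_order_def algebraic_int_altdef_ipoly)
  have of_int: "\<phi> (of_int n) = of_int n" for n
  proof -
    have "\<phi> (of_nat k) = of_nat k" for k by (induction k) (simp_all add: hom_add)
    then show ?thesis by (cases n) (simp_all add: hom_uminus hom_minus)
  qed
  have "\<phi> (poly (map_poly of_int p) x) = poly (map_poly of_int p) (\<phi> x)"
    by (simp add: poly_altdef hom_sum hom_mult hom_power of_int)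
  with p show ?thesis
    unfolding max_order_def algebraic_int_altdef_ipoly
    by (intro CollectI exI[of _ p]) simp
qed

section \<open>The power basis of a simple extension\<close>

lemmas (in field_hom) hom_arith = hom_add hom_mult hom_minus hom_uminus hom_sum

text \<open>
  Division with remainder: an element of least degree divides all others. This serves twice below,
  for the ideal of polynomials that vanish at \<open>\<theta>\<close> and for the ideal generated by two polynomials.
\<close>

lemma poly_ideal_generator:
  fixes I :: "'a::field poly set"
  assumes diff: "\<And>p q. p \<in> I \<Longrightarrow> q \<in> I \<Longrightarrow> p - q \<in> I"
    and mult: "\<And>p q. p \<in> I \<Longrightarrow> q * p \<in> I"
    and nz: "f \<in> I" "f \<noteq> 0"
  obtains g where "g \<in> I" "g \<noteq> 0" "\<And>p. p \<in> I \<Longrightarrow> g dvd p"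
proof -
  obtain g where g: "g \<in> I" "g \<noteq> 0"
    and min: "\<And>h. h \<in> I \<Longrightarrow> h \<noteq> 0 \<Longrightarrow> degree g \<le> degree h"
    using ex_has_least_nat[of "\<lambda>g. g \<in> I \<and> g \<noteq> 0" f degree] nz by blast
  have "g dvd p" if "p \<in> I" for p
  proof -
    have "p mod g = p - p div g * g" by (simp add: minus_div_mult_eq_mod)
    then have "p mod g \<in> I" using diff[OF that mult[OF g(1)]] by simp
    then have "p mod g = 0" using min[of "p mod g"] degree_mod_less[OF g(2), of p] by force
    then show ?thesis by (simp add: mod_eq_0_iff_dvd)
  qed
  with g that show thesis by blast
qed

text \<open>
  The generator of the ideal of polynomials vanishing at \<open>\<theta>\<close> divides \<open>P\<close> and is no unit, since a
  nonzero constant has no root; by irreducibility it is associated to \<open>P\<close>.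
\<close>

lemma irreducible_dvd_if_common_root:
  fixes \<phi> :: "'f::field \<Rightarrow> 'e::field"
  assumes "field_hom \<phi>" and P: "irreducible P"
    and roots: "poly (map_poly \<phi> P) \<theta> = 0" "poly (map_poly \<phi> q) \<theta> = 0"
  shows "P dvd q"
proof -
  interpret field_hom \<phi> by fact
  interpret map_poly: map_poly_comm_ring_hom \<phi> ..
  let ?I = "{q. poly (map_poly \<phi> q) \<theta> = 0}"
  obtain g where g: "g \<in> ?I" "g \<noteq> 0" "\<And>p. p \<in> ?I \<Longrightarrow> g dvd p"
    by (rule poly_ideal_generator[of ?I P]) (use P roots in \<open>auto simp: map_poly.hom_minus map_poly.hom_mult\<close>)
  have "\<not> g dvd 1"
  proof
    assume "g dvd 1"
    then obtain k where "1 = g * k" unfolding dvd_def by blast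
    then have "map_poly \<phi> g * map_poly \<phi> k = 1" by (metis map_poly.hom_mult map_poly.hom_one)
    then have "poly (map_poly \<phi> g) \<theta> * poly (map_poly \<phi> k) \<theta> = 1" by (metis poly_1 poly_mult)
    then show False using g(1) by simp
  qed
  moreover have "g dvd P" using g(3) roots by simp
  ultimately have "P dvd g" using irreducibleD'[OF P] by blast
  then show ?thesis using g(3)[of q] roots by (auto intro: dvd_trans)
qed

lemma irreducible_bezout:
  fixes P :: "'f::field poly"
  assumes P: "irreducible P" and "\<not> P dvd q"
  obtains u v where "u * q + v * P = 1"
proof -
  let ?I = "{u * q + v * P | u v. True}"
  have I: "p \<in> ?I \<Longrightarrow> q' \<in> ?I \<Longrightarrow> p - q' \<in> ?I" for p q'
  proof -
    assume "p \<in> ?I" "q' \<in> ?I"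
    then obtain u v u' v' where "p = u * q + v * P" "q' = u' * q + v' * P" by auto
    then have "p - q' = (u - u') * q + (v - v') * P" by (simp add: algebra_simps)
    then show ?thesis by blast
  qed
  have I2: "p \<in> ?I \<Longrightarrow> q' * p \<in> ?I" for p q'
  proof -
    assume "p \<in> ?I"
    then obtain u v where "p = u * q + v * P" by auto
    then have "q' * p = (q' * u) * q + (q' * v) * P" by (simp add: algebra_simps)
    then show ?thesis by blast
  qed
  have qI: "q \<in> ?I" by (rule CollectI, rule exI[of _ 1], rule exI[of _ 0]) simp
  have PI: "P \<in> ?I" by (rule CollectI, rule exI[of _ 0], rule exI[of _ 1]) simp
  obtain g where g: "g \<in> ?I" "\<And>p. p \<in> ?I \<Longrightarrow> g dvd p"
    by (rule poly_ideal_generator[OF I I2 PI]) (use P in auto)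
  have "\<not> P dvd g" using g(2)[OF qI] assms(2) by (auto intro: dvd_trans)
  then have "g dvd 1" using irreducibleD'[OF P g(2)[OF PI]] by simp
  then obtain k where "1 = k * g" unfolding dvd_def by (metis mult.commute)
  with I2[OF g(1), of k] have "1 \<in> ?I" by simp
  then show thesis using that by force
qed

text \<open>
  The polynomial expressions in \<open>\<theta>\<close> already form a field: a nonzero value \<open>q(\<theta>)\<close> comes from a \<open>q\<close>
  prime to \<open>P\<close>, and evaluating \<open>u * q + v * P = 1\<close> at \<open>\<theta>\<close> exhibits \<open>u(\<theta>)\<close> as its inverse.
\<close>

lemma field_adjoin_eq_poly_range:
  fixes \<phi> :: "'f::field \<Rightarrow> 'e::field"
  assumes "field_hom \<phi>" and P: "irreducible P" "poly (map_poly \<phi> P) \<theta> = 0"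
    and "x \<in> field_adjoin \<phi> \<theta>"
  shows "\<exists>q. x = poly (map_poly \<phi> q) \<theta>"
  using assms(4)
proof (induction rule: field_adjoin.induct)
  interpret field_hom \<phi> by fact
  interpret map_poly: map_poly_comm_ring_hom \<phi> ..
  note [simp] = map_poly.hom_add map_poly.hom_mult map_poly.hom_minus
  {
    case (base c)
    show ?case by (rule exI[of _ "monom c 0"]) (simp add: poly_monom)
  next
    case gen
    show ?case by (rule exI[of _ "monom 1 1"]) (simp add: poly_monom)
  next
    case (diff x y)
    then obtain p q where "x = poly (map_poly \<phi> p) \<theta>" "y = poly (map_poly \<phi> q) \<theta>" by auto
    then show ?case by (intro exI[of _ "p - q"]) simp
  next
    case (mult x y)
    then obtain p q where "x = poly (map_poly \<phi> p) \<theta>" "y = poly (map_poly \<phi> q) \<theta>" by auto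
    then show ?case by (intro exI[of _ "p * q"]) simp
  next
    case (inv x)
    then obtain q where q: "x = poly (map_poly \<phi> q) \<theta>" by auto
    show ?case
    proof (cases "P dvd q")
      case True
      then have "x = 0" using P(2) q by (auto elim: dvdE)
      then show ?thesis by (intro exI[of _ 0]) simp
    next
      case False
      then obtain u v where "u * q + v * P = 1" using irreducible_bezout[OF P(1)] by metis
      then have "poly (map_poly \<phi> (u * q + v * P)) \<theta> = 1" by simp
      then have "poly (map_poly \<phi> u) \<theta> * x = 1" using P(2) q by simp
      then show ?thesis by (intro exI[of _ u]) (metis inverse_unique mult.commute)
    qed
  }
qed

lemma ext_vector_space:
  "field_hom \<phi> \<Longrightarrow> Vector_Spaces.vector_space (ext_scale (\<phi> :: 'f::field \<Rightarrow> 'e::field))"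
proof -
  assume "field_hom \<phi>"
  then interpret field_hom \<phi> .
  show ?thesis
    by unfold_locales (simp_all add: ext_scale_def hom_arith algebra_simps)
qed

text \<open>
  Criterion for a basis by sums over list positions. Distinctness of the list is a consequence: two
  equal entries would satisfy the relation with coefficients 1 and -1.
\<close>

lemma ext_basisI:
  fixes \<phi> :: "'f::field \<Rightarrow> 'e::field"
  assumes "field_hom \<phi>"
    and indep: "\<And>c. (\<Sum>i<length bs. \<phi> (c i) * bs ! i) = 0 \<Longrightarrow> \<forall>i<length bs. c i = 0"
    and gen: "\<And>x. \<exists>c. x = (\<Sum>i<length bs. \<phi> (c i) * bs ! i)"
  shows "ext_basis \<phi> bs"
proof -
  interpret field_hom \<phi> by fact
  interpret V: Vector_Spaces.vector_space "ext_scale \<phi>" by (rule ext_vector_space) fact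
  let ?n = "length bs"
  have dist: "distinct bs"
  proof (rule ccontr)
    assume "\<not> distinct bs"
    then obtain i j where ij: "i < ?n" "j < ?n" "i \<noteq> j" "bs ! i = bs ! j"
      by (auto simp: distinct_conv_nth)
    define c where "c k = (if k = i then 1 else 0) - (if k = j then 1 else (0 :: 'f))" for k
    have "(\<Sum>k<?n. \<phi> (c k) * bs ! k)
      = (\<Sum>k<?n. if k = i then bs ! k else 0) - (\<Sum>k<?n. if k = j then bs ! k else 0)"
      unfolding sum_subtractf[symmetric] by (rule sum.cong) (auto simp: c_def hom_arith)
    also have "\<dots> = 0" using ij by simp
    finally have "c i = 0" using indep ij(1) by blast
    then show False using ij(3) by (simp add: c_def)
  qed
  have nth: "(\<Sum>v\<in>set bs. u v * v) = (\<Sum>i<?n. u (bs ! i) * bs ! i)" for u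
    by (rule sum.reindex_bij_betw[symmetric, where h = "\<lambda>j. bs ! j"])
       (use dist in \<open>simp add: bij_betw_nth\<close>)
  have "\<not> V.dependent (set bs)"
  proof
    assume "V.dependent (set bs)"
    then obtain u v where u: "v \<in> set bs" "u v \<noteq> 0" "(\<Sum>v\<in>set bs. \<phi> (u v) * v) = 0"
      by (auto simp: V.dependent_finite ext_scale_def)
    from u(3) have "(\<Sum>i<?n. \<phi> (u (bs ! i)) * bs ! i) = 0"
      using nth[of "\<lambda>v. \<phi> (u v)"] by simp
    from indep[OF this] have "\<forall>i<?n. u (bs ! i) = 0" .
    with u show False by (auto simp: in_set_conv_nth)
  qed
  moreover have "x \<in> V.span (set bs)" for x
  proof -
    obtain c where c: "x = (\<Sum>i<?n. \<phi> (c i) * bs ! i)" using gen by blast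
    show ?thesis unfolding c
      unfolding ext_scale_def[symmetric] by (intro V.span_sum V.span_scale V.span_base) simp
  qed
  ultimately show ?thesis unfolding ext_basis_def using dist by blast
qed

text \<open>
  Existence and uniqueness of coordinates, again by list positions, which is the form that matrix
  entries need.
\<close>

lemma ext_basis_coordinates:
  fixes \<phi> :: "'f::field \<Rightarrow> 'e::field"
  assumes "field_hom \<phi>" and bs: "ext_basis \<phi> bs"
  shows "(\<Sum>i<length bs. \<phi> (module.representation (ext_scale \<phi>) (set bs) x (bs ! i)) * bs ! i) = x"
    and "(\<Sum>i<length bs. \<phi> (c i) * bs ! i) = (\<Sum>i<length bs. \<phi> (c' i) * bs ! i)
      \<Longrightarrow> i < length bs \<Longrightarrow> c i = c' i"
proof -
  interpret field_hom \<phi> by fact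
  interpret V: Vector_Spaces.vector_space "ext_scale \<phi>" by (rule ext_vector_space) fact
  let ?n = "length bs"
  from bs have dist: "distinct bs" and ind: "V.independent (set bs)"
    and span: "V.span (set bs) = UNIV" by (auto simp: ext_basis_def)
  have nth: "(\<Sum>v\<in>set bs. f v) = (\<Sum>i<?n. f (bs ! i))" for f :: "'e \<Rightarrow> 'e"
    by (rule sum.reindex_bij_betw[symmetric, where h = "\<lambda>j. bs ! j"])
       (use dist in \<open>simp add: bij_betw_nth\<close>)
  show "(\<Sum>i<?n. \<phi> (V.representation (set bs) x (bs ! i)) * bs ! i) = x"
    using V.sum_representation_eq[OF ind, of x "set bs"] span nth by (simp add: ext_scale_def)
  assume eq: "(\<Sum>i<?n. \<phi> (c i) * bs ! i) = (\<Sum>i<?n. \<phi> (c' i) * bs ! i)" and i: "i < ?n"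
  define u where "u v = (let k = (THE k. k < ?n \<and> bs ! k = v) in c k - c' k)" for v
  have u: "u (bs ! k) = c k - c' k" if "k < ?n" for k
  proof -
    have "(THE k'. k' < ?n \<and> bs ! k' = bs ! k) = k"
      by (rule the_equality) (use that dist in \<open>auto simp: nth_eq_iff_index_eq\<close>)
    then show ?thesis by (simp add: u_def)
  qed
  have "(\<Sum>v\<in>set bs. ext_scale \<phi> (u v) v) = (\<Sum>k<?n. \<phi> (c k - c' k) * bs ! k)"
    unfolding nth by (rule sum.cong) (auto simp: u ext_scale_def)
  also have "\<dots> = 0" using eq by (simp add: hom_arith left_diff_distrib sum_subtractf)
  finally have "\<forall>v\<in>set bs. u v = 0" using ind by (auto simp: V.dependent_finite)
  then show "c i = c' i" using u[OF i] i by auto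
qed

lemma ext_degree_eq_length_basis:
  fixes \<phi> :: "'f::field \<Rightarrow> 'e::field"
  assumes "field_hom \<phi>" and bs: "ext_basis \<phi> bs"
  shows "ext_degree \<phi> = length bs"
proof -
  interpret V: Vector_Spaces.vector_space "ext_scale \<phi>" by (rule ext_vector_space) fact
  show ?thesis unfolding ext_degree_def
    using bs by (intro V.dim_unique[of "set bs"]) (auto simp: ext_basis_def distinct_card)
qed

lemma irreducible_degree_pos:
  fixes P :: "'a::field poly"
  assumes "irreducible P"
  shows "degree P > 0"
  using assms is_unit_iff_degree[of P] by (auto dest: irreducible_not_unit)

text \<open>
  A linear relation between the powers below \<open>degree P\<close> is a polynomial of smaller degree vanishing
  at \<open>\<theta>\<close>, hence divisible by \<open>P\<close> and zero. Conversely, reduction modulo \<open>P\<close> brings every polynomial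
  expression in \<open>\<theta>\<close> below that degree.
\<close>

lemma power_basis:
  fixes \<phi> :: "'f::field \<Rightarrow> 'e::field"
  assumes "field_hom \<phi>" and P: "irreducible P" "poly (map_poly \<phi> P) \<theta> = 0"
    and adj: "field_adjoin \<phi> \<theta> = UNIV"
  shows "ext_basis \<phi> (map (\<lambda>i. \<theta> ^ i) [0..<degree P])"
proof (rule ext_basisI)
  interpret field_hom \<phi> by fact
  interpret map_poly: map_poly_comm_ring_hom \<phi> ..
  let ?d = "degree P"
  show "field_hom \<phi>" by fact
  have P0: "P \<noteq> 0" using P(1) by auto
  have eval: "poly (map_poly \<phi> q) \<theta> = (\<Sum>i<?d. \<phi> (coeff q i) * \<theta> ^ i)"
    if "degree q < ?d" for q
  proof -
    have "poly (map_poly \<phi> q) \<theta> = (\<Sum>i\<le>degree q. \<phi> (coeff q i) * \<theta> ^ i)"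
      by (simp add: poly_altdef)
    also have "\<dots> = (\<Sum>i<?d. \<phi> (coeff q i) * \<theta> ^ i)"
      by (rule sum.mono_neutral_left) (use that in \<open>auto simp: coeff_eq_0\<close>)
    finally show ?thesis .
  qed
  have d: "?d > 0" using irreducible_degree_pos[OF P(1)] .
  fix c :: "nat \<Rightarrow> 'f"
  assume "(\<Sum>i<length (map (\<lambda>i. \<theta> ^ i) [0..<?d]). \<phi> (c i) * map (\<lambda>i. \<theta> ^ i) [0..<?d] ! i) = 0"
  then have rel: "(\<Sum>i<?d. \<phi> (c i) * \<theta> ^ i) = 0" by simp
  define q where "q = (\<Sum>i<?d. monom (c i) i)"
  have cq: "coeff q i = (if i < ?d then c i else 0)" for i
    by (simp add: q_def coeff_sum)
  have dq: "degree q < ?d"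
    using d by (intro degree_lessI) (auto simp: cq)
  have "poly (map_poly \<phi> q) \<theta> = 0" unfolding eval[OF dq] using rel by (simp add: cq)
  then have "P dvd q" using irreducible_dvd_if_common_root[OF \<open>field_hom \<phi>\<close> P] by blast
  then have "q = 0" using dq by (meson dvd_imp_degree_le leD)
  then show "\<forall>i<length (map (\<lambda>i. \<theta> ^ i) [0..<?d]). c i = 0"
    using cq by (metis coeff_0 diff_zero length_map length_upt)
next
  interpret field_hom \<phi> by fact
  interpret map_poly: map_poly_comm_ring_hom \<phi> ..
  let ?d = "degree P"
  fix x
  have P0: "P \<noteq> 0" using P(1) by auto
  obtain q where q: "x = poly (map_poly \<phi> q) \<theta>"
    using field_adjoin_eq_poly_range[OF \<open>field_hom \<phi>\<close> P] adj by blast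
  define r where "r = q mod P"
  have "q = q div P * P + r" by (simp add: r_def)
  then have "map_poly \<phi> q = map_poly \<phi> (q div P) * map_poly \<phi> P + map_poly \<phi> r"
    by (metis map_poly.hom_add map_poly.hom_mult)
  then have x: "x = poly (map_poly \<phi> r) \<theta>" using q P(2) by simp
  have "coeff r i = 0" if "i \<ge> ?d" for i
    using degree_mod_less[OF P0, of q] that by (auto simp: r_def coeff_eq_0)
  then have "x = (\<Sum>i<?d. \<phi> (coeff r i) * \<theta> ^ i)"
    unfolding x poly_altdef
    by (intro sum.mono_neutral_cong) (auto simp: coeff_eq_0 not_less)
  then show "\<exists>c. x = (\<Sum>i<length (map (\<lambda>i. \<theta> ^ i) [0..<?d]). \<phi> (c i) * map (\<lambda>i. \<theta> ^ i) [0..<?d] ! i)"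
    by auto
qed

section \<open>The relative norm\<close>

lemma mult_matrix_eqI:
  fixes \<phi> :: "'f::field \<Rightarrow> 'e::field"
  assumes "field_hom \<phi>" and bs: "ext_basis \<phi> bs" and A: "A \<in> carrier_mat (length bs) (length bs)"
    and col: "\<And>j. j < length bs \<Longrightarrow> (\<Sum>i<length bs. \<phi> (A $$ (i, j)) * bs ! i) = x * bs ! j"
  shows "mult_matrix \<phi> bs x = A"
proof (rule eq_matI)
  fix i j assume "i < dim_row A" "j < dim_col A"
  then have ij: "i < length bs" "j < length bs" using A by auto
  have "module.representation (ext_scale \<phi>) (set bs) (x * bs ! j) (bs ! i) = A $$ (i, j)"
    by (rule ext_basis_coordinates(2)[OF assms(1) bs _ ij(1)])
       (simp add: ext_basis_coordinates(1)[OF assms(1) bs] col[OF ij(2)])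
  then show "mult_matrix \<phi> bs x $$ (i, j) = A $$ (i, j)"
    using ij by (simp add: mult_matrix_def)
qed (use A in \<open>auto simp: mult_matrix_def\<close>)

lemma mult_matrix_column:
  fixes \<phi> :: "'f::field \<Rightarrow> 'e::field"
  assumes "field_hom \<phi>" and bs: "ext_basis \<phi> bs" and j: "j < length bs"
  shows "(\<Sum>i<length bs. \<phi> (mult_matrix \<phi> bs x $$ (i, j)) * bs ! i) = x * bs ! j"
  using j ext_basis_coordinates(1)[OF assms(1) bs, of "x * bs ! j"] by (simp add: mult_matrix_def)

definition coord_matrix :: "('f::field \<Rightarrow> 'e::field) \<Rightarrow> 'e list \<Rightarrow> 'e list \<Rightarrow> 'f mat" where
  "coord_matrix \<phi> bs cs = mat (length bs) (length cs)
     (\<lambda>(i, j). module.representation (ext_scale \<phi>) (set bs) (cs ! j) (bs ! i))"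

lemma sum_mat_mult_column:
  fixes \<phi> :: "'f::field \<Rightarrow> 'e::field"
  assumes "field_hom \<phi>" and A: "A \<in> carrier_mat n m" and B: "B \<in> carrier_mat m k" and j: "j < k"
  shows "(\<Sum>i<n. \<phi> ((A * B) $$ (i, j)) * f i) = (\<Sum>l<m. \<phi> (B $$ (l, j)) * (\<Sum>i<n. \<phi> (A $$ (i, l)) * f i))"
proof -
  interpret field_hom \<phi> by fact
  have "(\<Sum>i<n. \<phi> ((A * B) $$ (i, j)) * f i) = (\<Sum>i<n. \<Sum>l<m. \<phi> (B $$ (l, j)) * (\<phi> (A $$ (i, l)) * f i))"
    using A B j
    by (intro sum.cong refl) (simp add: scalar_prod_def hom_sum hom_mult sum_distrib_left
        atLeast0LessThan mult_ac)
  also have "\<dots> = (\<Sum>l<m. \<phi> (B $$ (l, j)) * (\<Sum>i<n. \<phi> (A $$ (i, l)) * f i))"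
    by (subst sum.swap) (simp add: sum_distrib_left)
  finally show ?thesis .
qed

text \<open>
  If \<open>C\<close> and \<open>D\<close> are the two matrices of the change of basis, then \<open>C * D = 1\<close> and
  \<open>M * C = C * N\<close> for the multiplication matrices \<open>M\<close> and \<open>N\<close>; both equations are verified by
  expanding columns and comparing coordinates. Determinants then agree.
\<close>

lemma det_mult_matrix_basis_independent:
  fixes \<phi> :: "'f::field \<Rightarrow> 'e::field"
  assumes hom: "field_hom \<phi>" and bs: "ext_basis \<phi> bs" and cs: "ext_basis \<phi> cs"
  shows "det (mult_matrix \<phi> bs x) = det (mult_matrix \<phi> cs x)"
proof -
  interpret field_hom \<phi> by fact
  define n where "n = length bs"
  have n': "length cs = n"
    using ext_degree_eq_length_basis[OF hom bs] ext_degree_eq_length_basis[OF hom cs]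
    by (simp add: n_def)
  define M where "M = mult_matrix \<phi> bs x"
  define N where "N = mult_matrix \<phi> cs x"
  define C where "C = coord_matrix \<phi> bs cs"
  define D where "D = coord_matrix \<phi> cs bs"
  have carr: "M \<in> carrier_mat n n" "N \<in> carrier_mat n n" "C \<in> carrier_mat n n" "D \<in> carrier_mat n n"
    by (auto simp: M_def N_def C_def D_def mult_matrix_def coord_matrix_def n_def n'[unfolded n_def])
  have colC: "(\<Sum>i<n. \<phi> (C $$ (i, j)) * bs ! i) = cs ! j" if "j < n" for j
    using that ext_basis_coordinates(1)[OF hom bs, of "cs ! j"]
    by (simp add: C_def coord_matrix_def n' flip: n_def)
  have colD: "(\<Sum>i<n. \<phi> (D $$ (i, j)) * cs ! i) = bs ! j" if "j < n" for j
    using that ext_basis_coordinates(1)[OF hom cs, of "bs ! j"]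
    by (simp add: D_def coord_matrix_def n' flip: n_def)
  have colM: "(\<Sum>i<n. \<phi> (M $$ (i, j)) * bs ! i) = x * bs ! j" if "j < n" for j
    using that mult_matrix_column[OF hom bs] by (simp add: M_def n_def)
  have colN: "(\<Sum>i<n. \<phi> (N $$ (i, j)) * cs ! i) = x * cs ! j" if "j < n" for j
    using that mult_matrix_column[OF hom cs] by (simp add: N_def n')
  have CD: "C * D = 1\<^sub>m n"
  proof (rule eq_matI)
    fix i j assume "i < dim_row (1\<^sub>m n :: 'f mat)" "j < dim_col (1\<^sub>m n :: 'f mat)"
    then have ij: "i < n" "j < n" by auto
    have "(\<Sum>i<n. \<phi> ((C * D) $$ (i, j)) * bs ! i) = (\<Sum>l<n. \<phi> (D $$ (l, j)) * cs ! l)"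
      unfolding sum_mat_mult_column[OF hom carr(3,4) ij(2)] by (simp add: colC)
    also have "\<dots> = bs ! j" using colD ij by simp
    also have "\<dots> = (\<Sum>i<n. if i = j then bs ! i else 0)" using ij by simp
    also have "\<dots> = (\<Sum>i<n. \<phi> ((1\<^sub>m n :: 'f mat) $$ (i, j)) * bs ! i)"
      by (rule sum.cong) (use ij in auto)
    finally show "(C * D) $$ (i, j) = (1\<^sub>m n :: 'f mat) $$ (i, j)"
      using ext_basis_coordinates(2)[OF hom bs, of "\<lambda>i. (C * D) $$ (i, j)"
          "\<lambda>i. (1\<^sub>m n :: 'f mat) $$ (i, j)"] ij
      by (simp only: n_def)
  qed (use carr in auto)
  have MC: "M * C = C * N"
  proof (rule eq_matI)
    fix i j assume "i < dim_row (C * N)" "j < dim_col (C * N)"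
    then have ij: "i < n" "j < n" using carr by auto
    have "(\<Sum>i<n. \<phi> ((M * C) $$ (i, j)) * bs ! i) = (\<Sum>l<n. \<phi> (C $$ (l, j)) * (x * bs ! l))"
      unfolding sum_mat_mult_column[OF hom carr(1,3) ij(2)] by (simp add: colM)
    also have "\<dots> = x * (\<Sum>l<n. \<phi> (C $$ (l, j)) * bs ! l)"
      by (simp add: sum_distrib_left mult_ac)
    also have "\<dots> = x * cs ! j" using colC ij by simp
    also have "\<dots> = (\<Sum>l<n. \<phi> (N $$ (l, j)) * cs ! l)" using colN ij by simp
    also have "\<dots> = (\<Sum>i<n. \<phi> ((C * N) $$ (i, j)) * bs ! i)"
      unfolding sum_mat_mult_column[OF hom carr(3,2) ij(2)] by (simp add: colC)
    finally show "(M * C) $$ (i, j) = (C * N) $$ (i, j)"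
      using ext_basis_coordinates(2)[OF hom bs, of "\<lambda>i. (M * C) $$ (i, j)" "\<lambda>i. (C * N) $$ (i, j)"] ij
      by (simp only: n_def)
  qed (use carr in auto)
  have "det C * det D = 1"
    using arg_cong[OF CD, of det] det_mult[OF carr(3,4)] by simp
  moreover have "det M * det C = det C * det N"
    using arg_cong[OF MC, of det] det_mult[OF carr(1,3)] det_mult[OF carr(3,2)] by simp
  ultimately show ?thesis unfolding M_def N_def by (auto simp: mult.commute)
qed

text \<open>
  The norm is defined through a basis that is merely chosen; independence of the basis makes it
  computable in any given one.
\<close>

lemma rel_norm_eq_det:
  fixes \<phi> :: "'f::field \<Rightarrow> 'e::field"
  assumes "field_hom \<phi>" and "ext_basis \<phi> bs"
  shows "rel_norm \<phi> x = det (mult_matrix \<phi> bs x)"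
  unfolding rel_norm_def
  using det_mult_matrix_basis_independent[OF assms(1) _ assms(2)] someI[of "ext_basis \<phi>" bs] assms(2)
  by blast

definition companion_mat :: "nat \<Rightarrow> (nat \<Rightarrow> 'a::comm_ring_1) \<Rightarrow> 'a mat" where
  "companion_mat d c = mat d d (\<lambda>(i, j). if Suc j = d then c i else if i = Suc j then 1 else 0)"

text \<open>
  Outside the last column the first row vanishes, and the complementary minor is an
  identity matrix.
\<close>

lemma det_companion_mat:
  assumes "d > 0"
  shows "det (companion_mat d c) = (- 1) ^ (d - 1) * c 0"
proof -
  let ?A = "companion_mat d c"
  have A: "?A \<in> carrier_mat d d" by (simp add: companion_mat_def)
  have minor: "mat_delete ?A 0 (d - 1) = 1\<^sub>m (d - 1)"
    by (rule eq_matI) (auto simp: mat_delete_def companion_mat_def)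
  have "det ?A = (\<Sum>j<d. ?A $$ (0, j) * cofactor ?A 0 j)"
    by (rule laplace_expansion_row[OF A assms])
  also have "\<dots> = (\<Sum>j<d. if j = d - 1 then c 0 * cofactor ?A 0 (d - 1) else 0)"
    by (rule sum.cong) (use assms in \<open>auto simp: companion_mat_def\<close>)
  also have "\<dots> = c 0 * cofactor ?A 0 (d - 1)" using assms by simp
  finally show ?thesis by (simp add: cofactor_def minor del: One_nat_def)
qed

text \<open>
  In the power basis, multiplication by \<open>\<theta>\<close> shifts each basis vector to the next and rewrites
  \<open>\<theta> ^ degree P\<close> by the equation of \<open>\<theta>\<close>, so its matrix is the companion matrix of \<open>P\<close>.
\<close>

lemma rel_norm_generator:
  fixes \<phi> :: "'f::field \<Rightarrow> 'e::field"
  assumes hom: "field_hom \<phi>" and P: "irreducible P" "lead_coeff P = 1" "poly (map_poly \<phi> P) \<theta> = 0"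
    and adj: "field_adjoin \<phi> \<theta> = UNIV"
  shows "rel_norm \<phi> \<theta> = (- 1) ^ degree P * coeff P 0"
proof -
  interpret field_hom \<phi> by fact
  let ?d = "degree P" and ?bs = "map (\<lambda>i. \<theta> ^ i) [0..<degree P]"
  let ?A = "companion_mat ?d (\<lambda>i. - coeff P i)"
  have P0: "P \<noteq> 0" using P(1) by auto
  have d: "?d > 0" using irreducible_degree_pos[OF P(1)] .
  have bs: "ext_basis \<phi> ?bs" by (rule power_basis[OF hom P(1,3) adj])
  have "poly (map_poly \<phi> P) \<theta> = (\<Sum>i<?d. \<phi> (coeff P i) * \<theta> ^ i) + \<theta> ^ ?d"
    using P(2) by (simp add: poly_altdef flip: lessThan_Suc_atMost)
  then have rel: "\<theta> ^ ?d = (\<Sum>i<?d. \<phi> (- coeff P i) * \<theta> ^ i)"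
    using P(3) by (simp add: hom_arith sum_negf eq_neg_iff_add_eq_0 add.commute)
  have "mult_matrix \<phi> ?bs \<theta> = ?A"
  proof (rule mult_matrix_eqI[OF hom bs])
    show "?A \<in> carrier_mat (length ?bs) (length ?bs)" by (simp add: companion_mat_def)
    fix j assume "j < length ?bs"
    then have j: "j < ?d" by simp
    have "(\<Sum>i<?d. \<phi> (?A $$ (i, j)) * \<theta> ^ i) = \<theta> * \<theta> ^ j"
    proof (cases "Suc j = ?d")
      case True
      then have "(\<Sum>i<?d. \<phi> (?A $$ (i, j)) * \<theta> ^ i) = (\<Sum>i<?d. \<phi> (- coeff P i) * \<theta> ^ i)"
        by (intro sum.cong) (auto simp: companion_mat_def)
      also have "\<dots> = \<theta> ^ Suc j" using rel True by simp
      finally show ?thesis by simp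
    next
      case False
      then have "(\<Sum>i<?d. \<phi> (?A $$ (i, j)) * \<theta> ^ i) = (\<Sum>i<?d. if i = Suc j then \<theta> ^ i else 0)"
        using j by (intro sum.cong) (auto simp: companion_mat_def)
      also have "\<dots> = \<theta> ^ Suc j" using j False by simp
      finally show ?thesis by simp
    qed
    then show "(\<Sum>i<length ?bs. \<phi> (?A $$ (i, j)) * ?bs ! i) = \<theta> * ?bs ! j"
      using j by simp
  qed
  then have "rel_norm \<phi> \<theta> = (- 1) ^ (?d - 1) * - coeff P 0"
    by (simp only: rel_norm_eq_det[OF hom bs] det_companion_mat[OF d])
  then show ?thesis using d by (cases ?d) auto
qed

section \<open>Principal fractional ideals\<close>

lemma mult_mem_ideal_prod:
  "x \<in> I \<Longrightarrow> y \<in> J \<Longrightarrow> x * y \<in> ideal_prod I J"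
  unfolding ideal_prod_def
  by (rule CollectI, rule exI[of _ "\<lambda>_. x"], rule exI[of _ "\<lambda>_. y"], rule exI[of _ 1]) simp

text \<open>
  A product ideal consists of finite sums of products; since a principal ideal is closed under sums,
  containment only has to be tested on single products.
\<close>

lemma ideal_prod_le_principal:
  assumes "\<And>x y. x \<in> I \<Longrightarrow> y \<in> J \<Longrightarrow> x * y \<in> principal_ideal c"
  shows "ideal_prod I J \<subseteq> principal_ideal c"
proof
  fix z assume "z \<in> ideal_prod I J"
  then obtain f g and n :: nat where z: "z = (\<Sum>k<n. f k * g k)" and "\<forall>k<n. f k \<in> I" "\<forall>k<n. g k \<in> J"
    unfolding ideal_prod_def by auto
  then have "\<forall>k. \<exists>r. k < n \<longrightarrow> f k * g k = c * r \<and> r \<in> max_order"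
    using assms by (force simp: principal_ideal_def)
  then obtain r where r: "\<And>k. k < n \<Longrightarrow> f k * g k = c * r k \<and> r k \<in> max_order" by metis
  then have "z = c * (\<Sum>k<n. r k)" unfolding z by (simp add: sum_distrib_left)
  moreover have "(\<Sum>k<n. r k) \<in> max_order" using r by (intro max_order_sum) auto
  ultimately show "z \<in> principal_ideal c" by (auto simp: principal_ideal_def)
qed

lemma ideal_prod_principal:
  "ideal_prod (principal_ideal x) (principal_ideal y) = principal_ideal (x * y)"
proof
  show "ideal_prod (principal_ideal x) (principal_ideal y) \<subseteq> principal_ideal (x * y)"
  proof (rule ideal_prod_le_principal)
    fix u w assume "u \<in> principal_ideal x" "w \<in> principal_ideal y"
    then obtain r s where "r \<in> max_order" "s \<in> max_order" "u * w = (x * y) * (r * s)"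
      by (auto simp: principal_ideal_def mult_ac)
    then show "u * w \<in> principal_ideal (x * y)"
      unfolding principal_ideal_def by (auto intro: max_order_mult)
  qed
  show "principal_ideal (x * y) \<subseteq> ideal_prod (principal_ideal x) (principal_ideal y)"
  proof
    fix z assume "z \<in> principal_ideal (x * y)"
    then obtain r where r: "r \<in> max_order" "z = (x * 1) * (y * r)"
      by (auto simp: principal_ideal_def mult_ac)
    show "z \<in> ideal_prod (principal_ideal x) (principal_ideal y)"
      unfolding r(2) using r(1) max_order_1
      by (intro mult_mem_ideal_prod) (auto simp: principal_ideal_def)
  qed
qed

lemma ideal_pow_principal: "ideal_pow (principal_ideal x) n = principal_ideal (x ^ n)"
  by (induction n) (simp_all add: ideal_prod_principal, simp add: principal_ideal_def)

text \<open>
  Together with the formula for powers, this reduces ambiguity of a principal ideal to an identity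
  between generators up to a unit.
\<close>

lemma ideal_embed_principal:
  assumes "field_hom \<phi>"
  shows "ideal_embed \<phi> (principal_ideal c) = principal_ideal (\<phi> c)"
proof
  interpret field_hom \<phi> by fact
  show "ideal_embed \<phi> (principal_ideal c) \<subseteq> principal_ideal (\<phi> c)"
    unfolding ideal_embed_def
  proof (rule ideal_prod_le_principal)
    fix u w :: 'b assume "u \<in> \<phi> ` principal_ideal c" "w \<in> max_order"
    then obtain r where r: "r \<in> max_order" "u * w = \<phi> c * (\<phi> r * w)"
      by (auto simp: principal_ideal_def hom_mult mult_ac)
    then show "u * w \<in> principal_ideal (\<phi> c)"
      using max_order_mult[OF max_order_hom[OF assms r(1)] \<open>w \<in> max_order\<close>]
      by (auto simp: principal_ideal_def)
  qed
  show "principal_ideal (\<phi> c) \<subseteq> ideal_embed \<phi> (principal_ideal c)"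
  proof -
    have "c \<in> principal_ideal c"
      unfolding principal_ideal_def using max_order_1 by (force intro: image_eqI[of _ _ 1])
    then show ?thesis
      unfolding ideal_embed_def by (auto simp: principal_ideal_def[of "\<phi> c"]
          intro!: mult_mem_ideal_prod)
  qed
qed

lemma principal_ideal_mult_unit:
  assumes "u \<in> unit_group"
  shows "principal_ideal (x * u) = principal_ideal x"
proof -
  from assms obtain w where u: "u \<in> max_order" and w: "w \<in> max_order" "u * w = 1"
    by (auto simp: unit_group_def)
  have "x * u * r \<in> principal_ideal x" if "r \<in> max_order" for r
    using that u by (auto simp: principal_ideal_def mult.assoc intro!: imageI max_order_mult)
  moreover have "x * r \<in> principal_ideal (x * u)" if "r \<in> max_order" for r
  proof -
    have "x * r = x * (u * w) * r" using w by simp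
    then have "x * r = x * u * (w * r)" by (simp only: mult.assoc)
    then show ?thesis
      unfolding principal_ideal_def by (rule image_eqI) (rule max_order_mult[OF w(1) that])
  qed
  ultimately show ?thesis by (auto simp: principal_ideal_def)
qed

lemma principal_ideal_fractional:
  fixes x :: "'a::field_char_0"
  assumes "x \<in> max_order" "x \<noteq> 0"
  shows "principal_ideal x \<in> fractional_ideals"
  unfolding fractional_ideals_def
proof (intro CollectI conjI ballI)
  show "0 \<in> principal_ideal x"
    using max_order_0 by (force simp: principal_ideal_def intro: image_eqI[of _ _ 0])
  have "x \<in> principal_ideal x"
    using max_order_1 by (force simp: principal_ideal_def intro: image_eqI[of _ _ 1])
  then show "principal_ideal x \<noteq> {0}" using assms(2) by auto
  show "\<exists>c\<in>max_order. c \<noteq> 0 \<and> (\<forall>y\<in>principal_ideal x. c * y \<in> max_order)"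
    using assms by (intro bexI[of _ 1]) (auto simp: principal_ideal_def max_order_closed)
next
  fix y z assume "y \<in> principal_ideal x" "z \<in> principal_ideal x"
  then show "y + z \<in> principal_ideal x"
    by (auto simp: principal_ideal_def max_order_add simp flip: distrib_left)
next
  fix r y assume "r \<in> (max_order :: 'a set)" "y \<in> principal_ideal x"
  then show "r * y \<in> principal_ideal x"
    by (auto simp: principal_ideal_def max_order_mult mult.left_commute)
qed

section \<open>Units from trinomials\<close>

lemma mem_max_order_iff: "x \<in> max_order \<longleftrightarrow> algebraic_int x"
  by (simp add: max_order_def)

text \<open>
  The factor \<open>u = 1 - v * \<theta> ^ t\<close> is integral, so the point is that its inverse \<open>w\<close> is integral, too.
  From \<open>u * w = 1\<close> one gets \<open>w - 1 = v * \<theta> ^ t * w\<close>. Raising this to the power \<open>d\<close> produces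
  \<open>(\<theta> ^ d) ^ t\<close>, and \<open>\<theta> ^ d * w = b\<close> absorbs it together with \<open>w ^ t\<close>:
  \<open>(w - 1) ^ d = v ^ d * b ^ t * w ^ (d - t)\<close>. As \<open>t \<ge> 1\<close>, the right-hand side has degree less than
  \<open>d\<close> in \<open>w\<close>, so this is a monic equation for \<open>w\<close> with integral coefficients.
\<close>

lemma trinomial_unit:
  fixes \<theta> b v :: "'a::field_char_0"
  assumes "b \<in> max_order" "v \<in> max_order" "\<theta> \<in> max_order" "\<theta> \<noteq> 0"
    and t: "1 \<le> t" "t < d" and rel: "\<theta> ^ d = b * (1 - v * \<theta> ^ t)"
  shows "1 - v * \<theta> ^ t \<in> unit_group"
proof -
  define u where "u = 1 - v * \<theta> ^ t"
  define w where "w = inverse u"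
  have u0: "u \<noteq> 0" using rel assms(4) by (auto simp: u_def)
  have uw: "u * w = 1" using u0 by (simp add: w_def)
  have w: "\<theta> ^ d * w = b" using rel uw by (simp add: u_def[symmetric] mult.assoc)
  have "w - 1 = v * \<theta> ^ t * w" using uw by (simp add: u_def algebra_simps)
  then have "(w - 1) ^ d = v ^ d * (\<theta> ^ d) ^ t * w ^ d"
    by (simp add: power_mult_distrib mult.commute flip: power_mult)
  also have "w ^ d = w ^ t * w ^ (d - t)" using t by (simp flip: power_add)
  also have "v ^ d * (\<theta> ^ d) ^ t * (w ^ t * w ^ (d - t)) = v ^ d * (\<theta> ^ d * w) ^ t * w ^ (d - t)"
    by (simp add: power_mult_distrib mult_ac)
  finally have eq: "(w - 1) ^ d = v ^ d * b ^ t * w ^ (d - t)" unfolding w .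
  define p where "p = [:- 1, 1:] ^ d + monom (- (v ^ d * b ^ t)) (d - t)"
  have deg: "degree ([:- 1, 1:] ^ d :: 'a poly) = d" by (simp add: degree_power_eq)
  have lt: "degree (monom (- (v ^ d * b ^ t)) (d - t)) < degree ([:- 1, 1:] ^ d :: 'a poly)"
    using t unfolding deg by (intro le_less_trans[OF degree_monom_le]) auto
  have "lead_coeff p = 1"
    unfolding p_def degree_add_eq_left[OF lt]
    using coeff_eq_0[OF lt] lead_coeff_power[of "[:- 1, 1 :: 'a:]" d] by simp
  moreover have "coeff ([:- 1, 1:] ^ n :: 'a poly) i \<in> max_order" for n i
    by (induction n arbitrary: i)
       (auto simp: coeff_pCons max_order_closed split: nat.splits intro!: max_order_closed)
  then have "\<forall>i. algebraic_int (coeff p i)"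
    using assms(1,2) unfolding p_def
    by (simp add: max_order_closed max_order_power mem_max_order_iff[symmetric])
  moreover have "poly p w = 0"
    using eq by (simp add: p_def poly_monom)
  ultimately have "w \<in> max_order"
    using algebraic_int_monic_root by (simp add: mem_max_order_iff)
  moreover have "u \<in> max_order"
    using assms(2,3) by (simp add: u_def max_order_closed max_order_power)
  ultimately show ?thesis
    using uw unfolding u_def[symmetric] unit_group_def by blast
qed

theorem theorem1:
  fixes \<phi> :: "'f::field_char_0 \<Rightarrow> 'e::field_char_0"
    and P :: "'f poly" and a b v :: 'f and \<theta> :: 'e and d t :: nat
  assumes "number_field TYPE('f)"
    and "field_hom \<phi>"
    and "1 \<le> t" and "t < d"
    and "a \<in> max_order" and "b \<in> max_order" and "v \<in> max_order"
    and "a = v * b"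
    and "P = monom 1 d + monom a t - monom b 0"
    and "irreducible P"
    and "poly (map_poly \<phi> P) \<theta> = 0"
    and "field_adjoin \<phi> \<theta> = UNIV"
  shows "ext_degree \<phi> = d
    \<and> ambiguous \<phi> (principal_ideal \<theta>)
    \<and> rel_norm \<phi> \<theta> = (-1) ^ (d - 1) * b
    \<and> \<theta> ^ d / \<phi> (rel_norm \<phi> \<theta>) = (-1) ^ (d - 1) * (1 - \<phi> v * \<theta> ^ t)
    \<and> \<theta> ^ d / \<phi> (rel_norm \<phi> \<theta>) \<in> unit_group"
proof -
  interpret field_hom \<phi> by fact
  interpret map_poly: map_poly_comm_ring_hom \<phi> ..
  note hom = \<open>field_hom \<phi>\<close> and root = \<open>poly (map_poly \<phi> P) \<theta> = 0\<close>
  note t = \<open>1 \<le> t\<close> \<open>t < d\<close> and v = \<open>v \<in> max_order\<close> and b = \<open>b \<in> max_order\<close>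
  have coeff_P: "coeff P i = (if i = d then 1 else if i = t then a else if i = 0 then - b else 0)" for i
    using t by (simp add: assms(9))
  have deg: "degree P = d"
    by (rule antisym) (use t in \<open>auto simp: coeff_P intro!: degree_le le_degree\<close>)
  have monic: "lead_coeff P = 1" by (simp add: deg coeff_P)
  have rel: "\<theta> ^ d = \<phi> b * (1 - \<phi> v * \<theta> ^ t)"
    using root by (simp add: assms(8,9) map_poly.hom_add map_poly.hom_minus poly_monom hom_mult
        algebra_simps)
  \<comment> \<open>For \<open>b = 0\<close> the polynomial is \<open>X ^ d\<close> with \<open>d \<ge> 2\<close>, which is reducible.\<close>
  have b0: "b \<noteq> 0"
  proof
    assume "b = 0"
    then have "P = monom 1 d" by (simp add: assms(8,9))
    also have "\<dots> = monom 1 1 * monom 1 (d - 1)" using t by (simp add: mult_monom)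
    finally have "monom 1 1 dvd (1 :: 'f poly) \<or> monom 1 (d - 1) dvd (1 :: 'f poly)"
      using irreducibleD[OF \<open>irreducible P\<close>] by blast
    then show False using t by (auto simp: is_unit_iff_degree degree_monom_eq)
  qed
  have \<theta>0: "\<theta> \<noteq> 0"
  proof
    assume "\<theta> = 0"
    then have "\<phi> b = 0" using rel t by (simp add: power_0_left)
    then show False using b0 by simp
  qed
  have bs: "ext_basis \<phi> (map (\<lambda>i. \<theta> ^ i) [0..<d])"
    using power_basis[OF hom \<open>irreducible P\<close> root \<open>field_adjoin \<phi> \<theta> = UNIV\<close>] deg by simp
  have degree: "ext_degree \<phi> = d"
    using ext_degree_eq_length_basis[OF hom bs] by simp
  have "\<theta> \<in> max_order"
    unfolding mem_max_order_iff
  proof (rule algebraic_int_monic_root)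
    show "lead_coeff (map_poly \<phi> P) = 1" using monic by simp
    have "coeff P i \<in> max_order" for i
      using assms(5) b by (simp add: coeff_P max_order_closed)
    then show "\<forall>i. algebraic_int (coeff (map_poly \<phi> P) i)"
      using max_order_hom[OF hom] by (simp add: mem_max_order_iff)
    show "poly (map_poly \<phi> P) \<theta> = 0" by fact
  qed
  have unit: "1 - \<phi> v * \<theta> ^ t \<in> unit_group"
    by (rule trinomial_unit[OF max_order_hom[OF hom b] max_order_hom[OF hom v] \<open>\<theta> \<in> max_order\<close>
          \<theta>0 t rel])
  have norm: "rel_norm \<phi> \<theta> = (- 1) ^ (d - 1) * b"
    using rel_norm_generator[OF hom \<open>irreducible P\<close> monic root \<open>field_adjoin \<phi> \<theta> = UNIV\<close>] t
    by (cases d) (simp_all add: deg coeff_P)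
  have quot: "\<theta> ^ d / \<phi> (rel_norm \<phi> \<theta>) = (- 1) ^ (d - 1) * (1 - \<phi> v * \<theta> ^ t)"
  proof -
    have "\<phi> (rel_norm \<phi> \<theta>) = (- 1) ^ (d - 1) * \<phi> b"
      by (simp add: norm hom_mult hom_power hom_uminus)
    then show ?thesis using b0 by (cases "even (d - 1)") (simp_all add: rel)
  qed
  \<comment> \<open>The sign of the norm does not affect whether the quotient is a unit.\<close>
  have sign: "(- 1) ^ n * u \<in> unit_group" if "u \<in> unit_group" for n and u :: 'e
  proof -
    from that obtain w where "u \<in> max_order" "w \<in> max_order" "u * w = 1"
      by (auto simp: unit_group_def)
    then show ?thesis
      unfolding unit_group_def
      by (cases "even n") (auto intro: max_order_uminus bexI[of _ w] bexI[of _ "- w"])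
  qed
  have "ideal_pow (principal_ideal \<theta>) d = principal_ideal (\<phi> b * (1 - \<phi> v * \<theta> ^ t))"
    unfolding ideal_pow_principal rel ..
  also have "\<dots> = principal_ideal (\<phi> b)" by (rule principal_ideal_mult_unit[OF unit])
  also have "\<dots> = ideal_embed \<phi> (principal_ideal b)" by (rule ideal_embed_principal[OF hom, symmetric])
  finally have "ambiguous \<phi> (principal_ideal \<theta>)"
    unfolding ambiguous_def degree
    using principal_ideal_fractional[OF \<open>\<theta> \<in> max_order\<close> \<theta>0] principal_ideal_fractional[OF b b0]
    by blast
  with degree norm quot sign[OF unit] show ?thesis by simp
qed

end
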